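(* Let $\mathbb{K}$ be a finite field of characteristic different from $2$ and $u\in\mathbb{K}^*$ with $u\notin\{1_{\mathbb{K}},-1_{\mathbb{K}}\}$. (i) If $u^2+4_{\mathbb{K}}$ is not a square in $\mathbb{K}$, then the $u$-trinomial minimal solution of $(E_{\mathbb{K}})$ is irreducible. (ii) Suppose that $u$ or $-u$ is a generator of the cyclic group $\mathbb{K}^*$. Then the $u$-trinomial minimal solution of $(E_{\mathbb{K}})$ is irreducible if and only if $u^2+4_{\mathbb{K}}$ is not a square in $\mathbb{K}$.
   Context: Let $A$ be a commutative unital ring ($0_A\neq 1_A$). For $a_1,\ldots,a_n\in A$ set $M_n(a_1,\ldots,a_n)=\begin{pmatrix} a_n & -1_A\\ 1_A & 0_A\end{pmatrix}\cdots\begin{pmatrix} a_1 & -1_A\\ 1_A & 0_A\end{pmatrix}$. An $n$-tuple is a solution of $(E_A)$ if $M_n(a_1,\ldots,a_n)=\pm \mathrm{Id}$. For tuples, $(a_1,\ldots,a_n)\oplus(b_1,\ldots,b_m)=(a_1+b_m,a_2,\ldots,a_{n-1},a_n+b_1,b_2,\ldots,b_{m-1})$. Write $(a_1,\ldots,a_n)\sim(b_1,\ldots,b_n)$ if $(b_1,\ldots,b_n)$ is obtained from $(a_1,\ldots,a_n)$ or from $(a_n,\ldots,a_1)$ by a cyclic permutation. A solution $(c_1,\ldots,c_n)$ with $n\geq 3$ is reducible if there exist a solution $(b_1,\ldots,b_l)$ and a tuple $(a_1,\ldots,a_m)$ of elements of $A$ with $l,m\geq 3$ and $(c_1,\ldots,c_n)\sim(a_1,\ldots,a_m)\oplus(b_1,\ldots,b_l)$;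 otherwise it is irreducible. For $A$ finite and $u$ a unit of $A$, the $u$-trinomial minimal solution of $(E_A)$ is the solution of the form $(u,u^{-1},u^{-1},\ldots,u,u^{-1},u^{-1})$ (the block $(u,u^{-1},u^{-1})$ repeated $k\geq 1$ times) of minimal size; it exists. $4_{\mathbb{K}}=1_{\mathbb{K}}+1_{\mathbb{K}}+1_{\mathbb{K}}+1_{\mathbb{K}}$. *)

theory Defs
  imports
    "HOL-Analysis.Analysis"
    "HOL-Computational_Algebra.Computational_Algebra"
begin

definition elem_matrix :: "'a::comm_ring_1 \<Rightarrow> 'a^2^2" where
  "elem_matrix a = vector [vector [a, - 1], vector [1, 0]]"

text \<open>
  The matrix \<open>M\<^sub>n(a\<^sub>1, \<dots>, a\<^sub>n)\<close> of the list \<open>[a\<^sub>1, \<dots>, a\<^sub>n]\<close>;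
  the factor of \<open>a\<^sub>1\<close> is the rightmost one.
\<close>

fun continuant_matrix :: "'a::comm_ring_1 list \<Rightarrow> 'a^2^2" where
  "continuant_matrix [] = mat 1"
| "continuant_matrix (a # as) = continuant_matrix as ** elem_matrix a"

definition is_solution :: "'a::comm_ring_1 list \<Rightarrow> bool" where
  "is_solution as \<longleftrightarrow>
     continuant_matrix as = mat 1 \<or> continuant_matrix as = - mat 1"

text \<open>
  \<open>(a\<^sub>1 + b\<^sub>m, a\<^sub>2, \<dots>, a\<^bsub>n-1\<^esub>, a\<^sub>n + b\<^sub>1, b\<^sub>2, \<dots>, b\<^bsub>m-1\<^esub>)\<close>; meaningful only for
  tuples of size at least 2, and used only for sizes at least 3.
\<close>

definition tuple_sum :: "'a::comm_ring_1 list \<Rightarrow> 'a list \<Rightarrow> 'a list" where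
  "tuple_sum as bs =
     [hd as + last bs] @ butlast (tl as) @ [last as + hd bs] @ butlast (tl bs)"

definition tuple_equiv :: "'a list \<Rightarrow> 'a list \<Rightarrow> bool" where
  "tuple_equiv as bs \<longleftrightarrow> (\<exists>k. bs = rotate k as \<or> bs = rotate k (rev as))"

definition reducible_solution :: "'a::comm_ring_1 list \<Rightarrow> bool" where
  "reducible_solution cs \<longleftrightarrow> is_solution cs \<and> length cs \<ge> 3 \<and>
     (\<exists>as bs. is_solution bs \<and> length as \<ge> 3 \<and> length bs \<ge> 3 \<and>
        tuple_equiv cs (tuple_sum as bs))"

definition irreducible_solution :: "'a::comm_ring_1 list \<Rightarrow> bool" where
  "irreducible_solution cs \<longleftrightarrow>
     is_solution cs \<and> length cs \<ge> 3 \<and> \<not> reducible_solution cs"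

definition trinomial_tuple :: "'a::field \<Rightarrow> nat \<Rightarrow> 'a list" where
  "trinomial_tuple u k = concat (replicate k [u, inverse u, inverse u])"

definition trinomial_minimal_solution :: "'a::field \<Rightarrow> 'a list" where
  "trinomial_minimal_solution u =
     trinomial_tuple u (LEAST k. k \<ge> 1 \<and> is_solution (trinomial_tuple u k))"

definition generates_units :: "'a::field \<Rightarrow> bool" where
  "generates_units u \<longleftrightarrow> u \<noteq> 0 \<and> range (\<lambda>n::int. u powi n) = {x. x \<noteq> 0}"

text \<open>
  Over a finite field the \<open>LEAST\<close> in \<^const>\<open>trinomial_minimal_solution\<close> is
  attained, so that the \<open>u\<close>-trinomial minimal solution is indeed a solution.
\<close>

lemma continuant_matrix_append:
  "continuant_matrix (xs @ ys) = continuant_matrix ys ** continuant_matrix xs"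
  by (induction xs) (simp_all add: matrix_mul_assoc)

lemma elem_matrix_right_inverse:
  fixes a :: "'a::comm_ring_1"
  shows "\<exists>B :: 'a^2^2. elem_matrix a ** B = mat 1"
proof
  show "elem_matrix a ** vector [vector [0, 1], vector [- 1, a]] = (mat 1 :: 'a^2^2)"
    by (simp add: elem_matrix_def vec_eq_iff forall_2 matrix_matrix_mult_def sum_2 mat_def)
qed

lemma continuant_matrix_right_inverse:
  fixes xs :: "'a::comm_ring_1 list"
  shows "\<exists>B :: 'a^2^2. continuant_matrix xs ** B = mat 1"
proof (induction xs)
  case Nil
  show ?case by (auto intro: exI[of _ "mat 1"])
next
  case (Cons a xs)
  obtain B where B: "continuant_matrix xs ** B = mat 1" using Cons by blast
  obtain C where C: "elem_matrix a ** C = mat 1" using elem_matrix_right_inverse by blast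
  have "continuant_matrix (a # xs) ** (C ** B)
      = continuant_matrix xs ** (elem_matrix a ** C) ** B"
    by (simp add: matrix_mul_assoc)
  with B C show ?case by auto
qed

lemma trinomial_tuple_add:
  "trinomial_tuple u (i + j) = trinomial_tuple u i @ trinomial_tuple u j"
  by (simp add: trinomial_tuple_def replicate_add)

lemma trinomial_solution_exists:
  fixes u :: "'a::{field, finite}"
  shows "\<exists>k\<ge>1. is_solution (trinomial_tuple u k)"
proof -
  let ?f = "\<lambda>k. continuant_matrix (trinomial_tuple u k)"
  have "\<not> inj ?f"
    using finite_imageD[of ?f UNIV] by auto
  then obtain i j where ij: "i < j" "?f i = ?f j"
    by (metis injI linorder_neqE_nat)
  obtain B where B: "?f i ** B = mat 1" using continuant_matrix_right_inverse by blast
  have "?f j = ?f (j - i) ** ?f i"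
    using ij(1) trinomial_tuple_add[of u i "j - i"] by (simp add: continuant_matrix_append)
  hence "?f (j - i) ** (?f i ** B) = ?f i ** B"
    using ij(2) by (simp add: matrix_mul_assoc)
  hence "?f (j - i) = mat 1" by (simp add: B)
  thus ?thesis using ij(1) by (intro exI[of _ "j - i"]) (auto simp: is_solution_def)
qed

lemma is_solution_trinomial_minimal_solution:
  fixes u :: "'a::{field, finite}"
  shows "is_solution (trinomial_minimal_solution u)"
  using LeastI_ex[OF trinomial_solution_exists[of u]]
  by (simp add: trinomial_minimal_solution_def)

end

theory Submission
  imports Defs
begin

text \<open>
  A solution is reducible exactly when it has, up to cyclic permutation and reversal, a block \<open>w\<close>
  of size between \<open>1\<close> and \<open>n - 3\<close> for which the upper left entry of \<open>M(w)\<close> is \<open>\<plusminus>1\<close>.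
  Let \<open>v = u\<^sup>-\<^sup>1\<close>. The matrices of the blocks \<open>(u, v, v)\<close>, \<open>(v, v, u)\<close>, \<open>(v, u, v)\<close> are triangular with
  diagonal entries \<open>-u\<close> and \<open>-v\<close>, so the tuple made of \<open>k\<close> blocks is a solution iff \<open>u^k = \<plusminus>1\<close>,
  and the upper left entries of all its cyclic blocks can be computed. By minimality of \<open>k\<close> the only
  ones that can be \<open>\<plusminus>1\<close> are those of \<open>(v, v, u, \<dots>, v, v, u, v, v)\<close>, equal to \<open>v\<^sup>2 / p - p\<close> with
  \<open>p = (-u)^j\<close>. This is \<open>\<plusminus>1\<close> iff \<open>p\<close> is a root of \<open>X\<^sup>2 \<plusminus> X - v\<^sup>2\<close>, whose discriminant is
  \<open>v\<^sup>2 (u\<^sup>2 + 4)\<close>; if \<open>u\<close> or \<open>-u\<close> is a generator, every nonzero element is \<open>\<plusminus>(-u)^j\<close> for some \<open>j < k\<close>.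
\<close>

section \<open>Two-by-two matrices given by their entries\<close>

definition matrix2 :: "'a \<Rightarrow> 'a \<Rightarrow> 'a \<Rightarrow> 'a \<Rightarrow> ('a::comm_ring_1)^2^2" where
  "matrix2 a b c d = vector [vector [a, b], vector [c, d]]"

lemma matrix2_mult:
  "matrix2 a b c d ** matrix2 a' b' c' d' =
     matrix2 (a * a' + b * c') (a * b' + b * d') (c * a' + d * c') (c * b' + d * d')"
  by (simp add: matrix2_def vec_eq_iff forall_2 matrix_matrix_mult_def sum_2)

lemma matrix2_eq_iff:
  "matrix2 a b c d = matrix2 a' b' c' d' \<longleftrightarrow> a = a' \<and> b = b' \<and> c = c' \<and> d = d'"
  by (auto simp add: matrix2_def vec_eq_iff forall_2)

lemma matrix2_nth [simp]:
  "matrix2 a b c d $ 1 $ 1 = a" "matrix2 a b c d $ 1 $ 2 = b"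
  "matrix2 a b c d $ 2 $ 1 = c" "matrix2 a b c d $ 2 $ 2 = d"
  by (simp_all add: matrix2_def)

lemma matrix2_collapse:
  fixes A :: "'a::comm_ring_1^2^2"
  shows "matrix2 (A $ 1 $ 1) (A $ 1 $ 2) (A $ 2 $ 1) (A $ 2 $ 2) = A"
  by (simp add: vec_eq_iff forall_2)

lemma mat_1_eq_matrix2: "mat 1 = matrix2 1 0 0 1"
  by (simp add: vec_eq_iff forall_2 mat_def)

lemma minus_matrix2: "- matrix2 a b c d = matrix2 (- a) (- b) (- c) (- d)"
  by (simp add: vec_eq_iff forall_2)

lemma elem_matrix_eq_matrix2: "elem_matrix a = matrix2 a (- 1) 1 0"
  by (simp add: elem_matrix_def matrix2_def)

lemma det_continuant_matrix: "det (continuant_matrix as) = 1"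
proof (induction as)
  case (Cons a as)
  have "det (elem_matrix a) = 1"
    by (simp add: det_2 elem_matrix_eq_matrix2)
  then show ?case
    using Cons by (simp add: det_mul)
qed simp

lemma is_solution_iff_matrix2:
  "is_solution as \<longleftrightarrow> (\<exists>e. (e = 1 \<or> e = - 1) \<and> continuant_matrix as = matrix2 e 0 0 e)"
  unfolding is_solution_def mat_1_eq_matrix2 minus_matrix2 minus_zero by blast

section \<open>Reducibility in terms of the corner entry of a block\<close>

lemma continuant_matrix_bordered:
  fixes w :: "'a::comm_ring_1 list"
  assumes "continuant_matrix w = matrix2 a b c d"
  shows "continuant_matrix (x # w @ [y]) =
    matrix2 (y * (a * x + b) - (c * x + d)) (c - y * a) (a * x + b) (- a)"
  by (simp add: continuant_matrix_append assms elem_matrix_eq_matrix2 matrix2_mult matrix2_eq_iff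
      algebra_simps)

text \<open>Bordering \<open>w\<close> puts \<open>- a\<close> in the lower right corner, whatever
  \<open>x\<close> and \<open>y\<close> are, so \<open>a\<close> must be a sign. Conversely, when
  \<open>a\<close> is a sign, \<open>x\<close> and \<open>y\<close> can be chosen to kill the
  off-diagonal entries, and the determinant then forces the upper left entry to be
  \<open>- a\<close> as well.\<close>

lemma ex_bordered_solution_iff:
  fixes w :: "'a::comm_ring_1 list"
  shows "(\<exists>x y. is_solution (x # w @ [y])) \<longleftrightarrow> continuant_matrix w $ 1 $ 1 \<in> {1, - 1}"
proof -
  define a b c d where "a = continuant_matrix w $ 1 $ 1" and "b = continuant_matrix w $ 1 $ 2"
    and "c = continuant_matrix w $ 2 $ 1" and "d = continuant_matrix w $ 2 $ 2"
  have w: "continuant_matrix w = matrix2 a b c d"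
    unfolding a_def b_def c_def d_def by (rule matrix2_collapse[symmetric])
  have det: "a * d - b * c = 1"
    using det_continuant_matrix[of w] by (simp add: w det_2)
  show ?thesis
  proof
    assume "\<exists>x y. is_solution (x # w @ [y])"
    then have "- a = 1 \<or> - a = - 1"
      unfolding is_solution_iff_matrix2 continuant_matrix_bordered[OF w] matrix2_eq_iff by blast
    then have "a = - 1 \<or> a = 1" by (metis minus_minus)
    then show "continuant_matrix w $ 1 $ 1 \<in> {1, - 1}" by (auto simp: w)
  next
    assume "continuant_matrix w $ 1 $ 1 \<in> {1, - 1}"
    then have a: "a = 1 \<or> a = - 1" by (simp add: w)
    \<comment> \<open>Since \<open>a * a = 1\<close>, these borders solve
      \<open>a * x + b = 0\<close> and \<open>c - y * a = 0\<close>.\<close>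
    then have sol: "is_solution ((- a * b) # w @ [a * c])"
    proof
      assume "a = 1"
      with det show ?thesis
        unfolding is_solution_iff_matrix2 continuant_matrix_bordered[OF w] matrix2_eq_iff
        by (intro exI[of _ "- 1"]) (simp add: algebra_simps)
    next
      assume "a = - 1"
      moreover have "b * c + d = - (- 1 * d - b * c)" by simp
      with det \<open>a = - 1\<close> have "b * c + d = - 1" by simp
      ultimately show ?thesis
        unfolding is_solution_iff_matrix2 continuant_matrix_bordered[OF w] matrix2_eq_iff
        by (intro exI[of _ 1]) (simp add: algebra_simps)
    qed
    then show "\<exists>x y. is_solution (x # w @ [y])" by blast
  qed
qed

lemma bordered_decomp:
  assumes "length xs \<ge> 2"
  shows "xs = hd xs # butlast (tl xs) @ [last xs]"
  using assms by (cases xs; cases "tl xs") auto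

lemma tuple_equiv_length: "tuple_equiv as bs \<Longrightarrow> length bs = length as"
  by (auto simp: tuple_equiv_def)

text \<open>The tuple \<open>as\<close> in a sum need not be a solution, so its two end entries can
  absorb any end entries of \<open>bs\<close>. Hence only the interior \<open>w\<close> of
  \<open>bs\<close> matters: the rest \<open>r\<close> of the cycle is arbitrary of size at least 3,
  and \<open>w\<close> must admit borders that turn it into a solution.\<close>

lemma reducible_solution_iff:
  fixes cs :: "'a::comm_ring_1 list"
  shows "reducible_solution cs \<longleftrightarrow> is_solution cs \<and>
    (\<exists>r w. length r \<ge> 3 \<and> w \<noteq> [] \<and> tuple_equiv cs (r @ w) \<and>
       continuant_matrix w $ 1 $ 1 \<in> {1, - 1})" (is "_ \<longleftrightarrow> _ \<and> ?R")
proof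
  assume "reducible_solution cs"
  then obtain as bs where sol: "is_solution cs" "is_solution bs"
    and len: "length as \<ge> 3" "length bs \<ge> 3" and eq: "tuple_equiv cs (tuple_sum as bs)"
    by (auto simp: reducible_solution_def)
  define r where "r = [hd as + last bs] @ butlast (tl as) @ [last as + hd bs]"
  define w where "w = butlast (tl bs)"
  have "bs = hd bs # w @ [last bs]"
    unfolding w_def using len(2) by (intro bordered_decomp) simp
  with sol(2) have "continuant_matrix w $ 1 $ 1 \<in> {1, - 1}"
    by (metis ex_bordered_solution_iff)
  moreover have "length w \<ge> 1" using len by (simp add: w_def)
  then have "w \<noteq> []" by auto
  moreover have "length r \<ge> 3" using len by (simp add: r_def)
  moreover have "tuple_equiv cs (r @ w)" using eq by (simp add: r_def w_def tuple_sum_def)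
  ultimately show "is_solution cs \<and> ?R" using sol(1) by blast
next
  assume "is_solution cs \<and> ?R"
  then obtain r w where sol: "is_solution cs" and len: "length r \<ge> 3" "w \<noteq> []"
    and eq: "tuple_equiv cs (r @ w)" and "continuant_matrix w $ 1 $ 1 \<in> {1, - 1}"
    by auto
  then obtain x y where xy: "is_solution (x # w @ [y])"
    using ex_bordered_solution_iff by blast
  \<comment> \<open>Forming the sum adds \<open>y\<close> to the first and \<open>x\<close> to the
    last entry of \<open>as\<close>; subtracting them beforehand recovers \<open>r\<close>.\<close>
  define as where "as = (hd r - y) # butlast (tl r) @ [last r - x]"
  have "tuple_sum as (x # w @ [y]) = hd r # butlast (tl r) @ [last r] @ w"
    by (simp add: tuple_sum_def as_def)
  also have "\<dots> = r @ w"
    using arg_cong[OF bordered_decomp[of r], of "\<lambda>xs. xs @ w"] len by simp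
  finally have "tuple_equiv cs (tuple_sum as (x # w @ [y]))" using eq by simp
  moreover have "length as \<ge> 3" using len by (simp add: as_def)
  moreover have "length (x # w @ [y]) \<ge> 3" using len by (cases w) auto
  moreover have "length cs \<ge> 3" using tuple_equiv_length[OF eq] len by simp
  ultimately show "reducible_solution cs"
    unfolding reducible_solution_def using sol xy by blast
qed

section \<open>Cyclic blocks of the tuple as factors of a 3-periodic sequence\<close>

definition trinomial_entry :: "'a::field \<Rightarrow> nat \<Rightarrow> 'a" where
  "trinomial_entry u i = (if 3 dvd i then u else inverse u)"

text \<open>Start and length replace rotations of lists: every cyclic block is such a word, and only
  \<open>m\<close> modulo 3 matters, which leaves three starting points.\<close>

definition trinomial_word :: "'a::field \<Rightarrow> nat \<Rightarrow> nat \<Rightarrow> 'a list" where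
  "trinomial_word u m n = map (\<lambda>i. trinomial_entry u (m + i)) [0..<n]"

lemma length_trinomial_word [simp]: "length (trinomial_word u m n) = n"
  by (simp add: trinomial_word_def)

lemma nth_trinomial_word [simp]: "i < n \<Longrightarrow> trinomial_word u m n ! i = trinomial_entry u (m + i)"
  by (simp add: trinomial_word_def)

lemma trinomial_word_0 [simp]: "trinomial_word u m 0 = []"
  by (simp add: trinomial_word_def)

lemma trinomial_word_Suc:
  "trinomial_word u m (Suc n) = trinomial_word u m n @ [trinomial_entry u (m + n)]"
  by (simp add: trinomial_word_def)

lemma trinomial_word_add:
  "trinomial_word u m (n + l) = trinomial_word u m n @ trinomial_word u (m + n) l"
  by (rule nth_equalityI) (auto simp: nth_append)

lemma trinomial_word_cong_mod:
  assumes "m mod 3 = m' mod 3"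
  shows "trinomial_word u m n = trinomial_word u m' n"
proof -
  have "(m + i) mod 3 = (m' + i) mod 3" for i
    using assms by (metis mod_add_left_eq)
  then show ?thesis by (simp add: trinomial_word_def trinomial_entry_def dvd_eq_mod_eq_0)
qed

lemma trinomial_word_3:
  "trinomial_word u 0 3 = [u, inverse u, inverse u]"
  "trinomial_word u 1 3 = [inverse u, inverse u, u]"
  "trinomial_word u 2 3 = [inverse u, u, inverse u]"
proof -
  have "[0..<3] = [0, 1, 2]" by (simp add: upt_rec)
  then show "trinomial_word u 0 3 = [u, inverse u, inverse u]"
    and "trinomial_word u 1 3 = [inverse u, inverse u, u]"
    and "trinomial_word u 2 3 = [inverse u, u, inverse u]"
    by (simp_all add: trinomial_word_def trinomial_entry_def dvd_eq_mod_eq_0 mod_Suc)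
qed

lemma trinomial_tuple_eq_word: "trinomial_tuple u k = trinomial_word u 0 (3 * k)"
proof (induction k)
  case 0
  show ?case by (simp add: trinomial_tuple_def)
next
  case (Suc k)
  have "trinomial_tuple u (Suc k) = trinomial_tuple u k @ trinomial_word u 0 3"
    using trinomial_tuple_add[of u k 1]
    by (simp add: trinomial_tuple_def trinomial_word_3)
  also have "trinomial_word u 0 3 = trinomial_word u (0 + 3 * k) 3"
    by (rule trinomial_word_cong_mod) simp
  finally show ?case
    using Suc by (simp add: trinomial_word_add[of u 0 "3 * k" 3] add.commute[of 3 "3 * k"])
qed

text \<open>Wrapping around modulo \<open>n\<close> preserves residues modulo 3 because 3 divides
  \<open>n\<close>.\<close>

lemma rotate_trinomial_word:
  assumes "3 dvd n"
  shows "rotate l (trinomial_word u m n) = trinomial_word u (m + l) n"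
proof (rule nth_equalityI)
  fix i assume "i < length (rotate l (trinomial_word u m n))"
  then have i: "i < n" by simp
  then have "(l + i) mod n < n" by simp
  moreover have "(m + (l + i) mod n) mod 3 = (m + l + i) mod 3"
    using assms by (metis add.assoc mod_add_right_eq mod_mod_cancel)
  ultimately show "rotate l (trinomial_word u m n) ! i = trinomial_word u (m + l) n ! i"
    using i by (simp only: nth_rotate nth_trinomial_word length_trinomial_word
        trinomial_entry_def dvd_eq_mod_eq_0)
qed simp

text \<open>Reversal sends position \<open>i\<close> to \<open>n - Suc i\<close>, which is divisible
  by 3 exactly when \<open>Suc i\<close> is. So reversal acts as a shift by one and yields nothing
  beyond the rotations.\<close>

lemma rev_trinomial_word:
  assumes "3 dvd n"
  shows "rev (trinomial_word u 0 n) = trinomial_word u 1 n"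
proof (rule nth_equalityI)
  fix i assume "i < length (rev (trinomial_word u 0 n))"
  then have i: "i < n" by simp
  have "3 dvd n - Suc i \<longleftrightarrow> 3 dvd Suc i"
    using i assms by (metis Suc_leI dvd_diffD1 dvd_diff_nat)
  with i show "rev (trinomial_word u 0 n) ! i = trinomial_word u 1 n ! i"
    by (simp add: rev_nth trinomial_entry_def)
qed simp

lemma tuple_equiv_trinomial_tuple_iff:
  "tuple_equiv (trinomial_tuple u k) ds \<longleftrightarrow> (\<exists>m. ds = trinomial_word u m (3 * k))"
  unfolding tuple_equiv_def trinomial_tuple_eq_word
  by (auto simp: rev_trinomial_word rotate_trinomial_word)

section \<open>Matrices and corner entries of the words\<close>

lemma continuant_trinomial_word_block:
  fixes u :: "'a::field"
  assumes "u \<noteq> 0"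
  defines "v \<equiv> inverse u"
  shows "continuant_matrix (trinomial_word u 0 (3 * j)) =
      matrix2 ((- u) ^ j) (- v * ((- u) ^ j - (- v) ^ j)) 0 ((- v) ^ j)" (is ?A)
    and "continuant_matrix (trinomial_word u 1 (3 * j)) =
      matrix2 ((- u) ^ j) 0 (v * ((- u) ^ j - (- v) ^ j)) ((- v) ^ j)" (is ?B)
    and "continuant_matrix (trinomial_word u 2 (3 * j)) =
      matrix2 ((- v) ^ j) 0 0 ((- u) ^ j)" (is ?C)
proof -
  have uv: "u * v = 1" "v * u = 1" "u * (v * x) = x" "v * (u * x) = x" for x
    using assms by (simp_all add: mult.assoc[symmetric])
  have step: "trinomial_word u m (3 * Suc j) = trinomial_word u m (3 * j) @ trinomial_word u m 3" for m j
    using trinomial_word_add[of u m "3 * j" 3] trinomial_word_cong_mod[of "m + 3 * j" m u 3]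
    by (simp add: add.commute)
  \<comment> \<open>For \<open>u\<close> not a sign, the \<open>j\<close>-th power of a triangular
    matrix with diagonal \<open>- u\<close>, \<open>- v\<close> has its off-diagonal entry
    multiplied by \<open>((- u) ^ j - (- v) ^ j) / (v - u)\<close>. As
    \<open>(1 - v * v) / (v - u) = - v\<close>, this gives the denominator-free closed forms, which
    remain true for \<open>u\<close> a sign.\<close>
  have three:
    "continuant_matrix (trinomial_word u 0 3) = matrix2 (- u) (1 - v * v) 0 (- v)"
    "continuant_matrix (trinomial_word u 1 3) = matrix2 (- u) 0 (v * v - 1) (- v)"
    "continuant_matrix (trinomial_word u 2 3) = matrix2 (- v) 0 0 (- u)"
    by (simp_all del: One_nat_def add: trinomial_word_3 elem_matrix_eq_matrix2 matrix2_mult matrix2_eq_iff uv algebra_simps flip: v_def)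
  show ?A
  proof (induction j)
    case (Suc j)
    then show ?case unfolding step continuant_matrix_append three
      by (simp only: matrix2_mult matrix2_eq_iff) (simp add: uv algebra_simps)
  qed (simp add: mat_1_eq_matrix2)
  show ?B
  proof (induction j)
    case (Suc j)
    then show ?case unfolding step continuant_matrix_append three
      by (simp only: matrix2_mult matrix2_eq_iff) (simp add: uv algebra_simps)
  qed (simp add: mat_1_eq_matrix2)
  show ?C
  proof (induction j)
    case (Suc j)
    then show ?case unfolding step continuant_matrix_append three
      by (simp only: matrix2_mult matrix2_eq_iff) (simp add: uv algebra_simps)
  qed (simp add: mat_1_eq_matrix2)
qed

text \<open>One or two further elementary factors are applied to the triangular block matrices.
  Start 1 with two extra letters is the only case giving a binomial: there the lower left entry of
  the block cancels the term \<open>v * v * (- u) ^ j\<close> but leaves a multiple of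
  \<open>(- v) ^ j\<close>.\<close>

lemma continuant_trinomial_word_corner:
  fixes u :: "'a::field"
  assumes "u \<noteq> 0"
  defines "v \<equiv> inverse u"
  shows "continuant_matrix (trinomial_word u 0 (3 * j)) $ 1 $ 1 = (- u) ^ j"
    and "continuant_matrix (trinomial_word u 0 (3 * j + 1)) $ 1 $ 1 = - ((- u) ^ Suc j)"
    and "continuant_matrix (trinomial_word u 0 (3 * j + 2)) $ 1 $ 1 = 0"
    and "continuant_matrix (trinomial_word u 1 (3 * j)) $ 1 $ 1 = (- u) ^ j"
    and "continuant_matrix (trinomial_word u 1 (3 * j + 1)) $ 1 $ 1 = - ((- v) ^ Suc j)"
    and "continuant_matrix (trinomial_word u 1 (3 * j + 2)) $ 1 $ 1 = v\<^sup>2 * (- v) ^ j - (- u) ^ j"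
    and "continuant_matrix (trinomial_word u 2 (3 * j)) $ 1 $ 1 = (- v) ^ j"
    and "continuant_matrix (trinomial_word u 2 (3 * j + 1)) $ 1 $ 1 = - ((- v) ^ Suc j)"
    and "continuant_matrix (trinomial_word u 2 (3 * j + 2)) $ 1 $ 1 = 0"
proof -
  have uv: "u * v = 1" "v * u = 1" "u * (v * x) = x" "v * (u * x) = x" for x
    using assms by (simp_all add: mult.assoc[symmetric])
  have entry: "trinomial_entry u (m + 3 * j) = trinomial_entry u m" for m
    by (simp add: trinomial_entry_def dvd_eq_mod_eq_0)
  have dvd: "trinomial_entry u (3 * j) = u" "trinomial_entry u (Suc (3 * j)) = v"
    "trinomial_entry u (Suc (Suc (3 * j))) = v" "trinomial_entry u (Suc (Suc (Suc (3 * j)))) = u"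
    using entry[of 0] entry[of "Suc 0"] entry[of "Suc (Suc 0)"] entry[of "Suc (Suc (Suc 0))"]
    by (simp_all add: trinomial_entry_def v_def dvd_eq_mod_eq_0 mod_Suc)
  note block = continuant_trinomial_word_block[OF assms(1), of j, folded v_def,
      unfolded One_nat_def]
  note simps = trinomial_word_Suc continuant_matrix_append block dvd elem_matrix_eq_matrix2
    matrix2_mult uv
  show "continuant_matrix (trinomial_word u 0 (3 * j)) $ 1 $ 1 = (- u) ^ j"
    and "continuant_matrix (trinomial_word u 0 (3 * j + 1)) $ 1 $ 1 = - ((- u) ^ Suc j)"
    and "continuant_matrix (trinomial_word u 0 (3 * j + 2)) $ 1 $ 1 = 0"
    and "continuant_matrix (trinomial_word u 1 (3 * j)) $ 1 $ 1 = (- u) ^ j"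
    and "continuant_matrix (trinomial_word u 1 (3 * j + 1)) $ 1 $ 1 = - ((- v) ^ Suc j)"
    and "continuant_matrix (trinomial_word u 1 (3 * j + 2)) $ 1 $ 1 = v\<^sup>2 * (- v) ^ j - (- u) ^ j"
    and "continuant_matrix (trinomial_word u 2 (3 * j)) $ 1 $ 1 = (- v) ^ j"
    and "continuant_matrix (trinomial_word u 2 (3 * j + 1)) $ 1 $ 1 = - ((- v) ^ Suc j)"
    and "continuant_matrix (trinomial_word u 2 (3 * j + 2)) $ 1 $ 1 = 0"
    by (simp_all add: simps, simp_all add: uv power2_eq_square algebra_simps)
qed

section \<open>Reducibility of the trinomial tuple as a quadratic equation\<close>

lemma power_uminus_in_signs_iff:
  fixes x :: "'a::comm_ring_1"
  shows "(- x) ^ n \<in> {1, - 1} \<longleftrightarrow> x ^ n \<in> {1, - 1}"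
  by (cases "even n") (auto simp: minus_equation_iff)

lemma inverse_in_signs_iff:
  fixes x :: "'a::field"
  shows "inverse x \<in> {1, - 1} \<longleftrightarrow> x \<in> {1, - 1}"
  by (metis insert_iff inverse_1 inverse_inverse_eq inverse_minus_eq empty_iff)

text \<open>With \<open>p = (- u) ^ k\<close>, the diagonal entries are \<open>p\<close> and
  \<open>inverse p\<close>, and the off-diagonal entry is a multiple of
  \<open>p - inverse p\<close>; this vanishes as soon as \<open>p\<close> is a sign.\<close>

lemma is_solution_trinomial_tuple_iff:
  fixes u :: "'a::field"
  assumes "u \<noteq> 0"
  shows "is_solution (trinomial_tuple u k) \<longleftrightarrow> u ^ k \<in> {1, - 1}"
proof -
  have v: "(- inverse u) ^ k = inverse ((- u) ^ k)"
    by (metis inverse_minus_eq power_inverse)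
  have "is_solution (trinomial_tuple u k) \<longleftrightarrow> (- u) ^ k \<in> {1, - 1}"
    unfolding is_solution_iff_matrix2 trinomial_tuple_eq_word
      continuant_trinomial_word_block(1)[OF assms] matrix2_eq_iff v by auto
  then show ?thesis by (simp only: power_uminus_in_signs_iff)
qed

lemma in_signs_iff_quadratic:
  fixes p v :: "'a::field"
  assumes "p \<noteq> 0"
  shows "v\<^sup>2 * inverse p - p \<in> {1, - 1} \<longleftrightarrow> (\<exists>e\<in>{1, - 1}. p\<^sup>2 + e * p = v\<^sup>2)"
proof -
  have "v\<^sup>2 * inverse p - p = e \<longleftrightarrow> p\<^sup>2 + e * p = v\<^sup>2" for e
    using assms by (auto simp: field_simps power2_eq_square)
  then show ?thesis by auto
qed

text \<open>Minimality of \<open>k\<close> rules out every corner entry that is a signed power,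
  which leaves the binomial one. The bound \<open>j + 2 \<le> k\<close> says that a block of size
  \<open>3 * j + 2\<close> leaves at least 3 entries of the cycle for \<open>r\<close>.\<close>

lemma reducible_trinomial_iff:
  fixes u :: "'a::field"
  assumes "u \<noteq> 0"
    and sol: "u ^ k \<in> {1, - 1}"
    and min: "\<And>j. 1 \<le> j \<Longrightarrow> j < k \<Longrightarrow> u ^ j \<notin> {1, - 1}"
  shows "reducible_solution (trinomial_tuple u k) \<longleftrightarrow>
    (\<exists>j. j + 2 \<le> k \<and> (\<exists>e\<in>{1, - 1}. ((- u) ^ j)\<^sup>2 + e * (- u) ^ j = (inverse u)\<^sup>2))"
proof -
  let ?v = "inverse u"
  have v: "(- ?v) ^ j = inverse ((- u) ^ j)" for j
    by (metis inverse_minus_eq power_inverse)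
  have min': "(- u) ^ j \<notin> {1, - 1}" "(- ?v) ^ j \<notin> {1, - 1}" if "1 \<le> j" "j < k" for j
    using min[OF that] unfolding v inverse_in_signs_iff power_uminus_in_signs_iff by auto
  have neg: "- x \<in> {1, - 1} \<longleftrightarrow> x \<in> {1, - 1}" for x :: 'a
    by (metis insert_iff minus_minus empty_iff)
  have zero: "0 \<notin> {1, - 1 :: 'a}" by simp
  have quad: "continuant_matrix (trinomial_word u 1 (3 * j + 2)) $ 1 $ 1 \<in> {1, - 1} \<longleftrightarrow>
      (\<exists>e\<in>{1, - 1}. ((- u) ^ j)\<^sup>2 + e * (- u) ^ j = ?v\<^sup>2)" for j
    unfolding continuant_trinomial_word_corner[OF assms(1)] v
    using assms by (intro in_signs_iff_quadratic) simp
  show ?thesis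
  proof
    assume "reducible_solution (trinomial_tuple u k)"
    then obtain r w m where r: "length r \<ge> 3" and w: "w \<noteq> []"
      and rw: "r @ w = trinomial_word u m (3 * k)"
      and corner: "continuant_matrix w $ 1 $ 1 \<in> {1, - 1}"
      unfolding reducible_solution_iff tuple_equiv_trinomial_tuple_iff by blast
    have len: "length r + length w = 3 * k"
      using arg_cong[OF rw, of length] by simp
    define n where "n = length w"
    have "r @ w = trinomial_word u m (length r) @ trinomial_word u (m + length r) n"
      using rw trinomial_word_add[of u m "length r" n] len by (simp add: n_def)
    then have "w = trinomial_word u (m + length r) n" by simp
    then have w': "w = trinomial_word u ((m + length r) mod 3) n"
      using trinomial_word_cong_mod[of "m + length r" "(m + length r) mod 3"] by simp
    have n: "1 \<le> n" "n + 3 \<le> 3 * k" using w len r by (auto simp: n_def Suc_le_eq)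
    define j where "j = n div 3"
    have "n = 3 * j + n mod 3" by (simp add: j_def)
    moreover have "n mod 3 = 0 \<or> n mod 3 = 1 \<or> n mod 3 = 2" by linarith
    ultimately consider "n = 3 * j" | "n = 3 * j + 1" | "n = 3 * j + 2" by auto
    note length_cases = this
    note vals = continuant_trinomial_word_corner[OF assms(1), of j]
    \<comment> \<open>The corner is 0, or up to sign a power of \<open>- u\<close> or
      \<open>- v\<close> with exponent \<open>j\<close> (for \<open>n = 3 * j\<close>) or
      \<open>Suc j\<close> (for \<open>n = 3 * j + 1\<close>). From \<open>1 \<le> n\<close> and
      \<open>n + 3 \<le> 3 * k\<close> this exponent lies between 1 and \<open>k - 1\<close>, where
      minimality applies.\<close>
    have not_corner:
      "n = 3 * j \<Longrightarrow> continuant_matrix (trinomial_word u 0 n) $ 1 $ 1 \<notin> {1, - 1}"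
      "n = 3 * j + 1 \<Longrightarrow> continuant_matrix (trinomial_word u 0 n) $ 1 $ 1 \<notin> {1, - 1}"
      "n = 3 * j + 2 \<Longrightarrow> continuant_matrix (trinomial_word u 0 n) $ 1 $ 1 \<notin> {1, - 1}"
      "n = 3 * j \<Longrightarrow> continuant_matrix (trinomial_word u 1 n) $ 1 $ 1 \<notin> {1, - 1}"
      "n = 3 * j + 1 \<Longrightarrow> continuant_matrix (trinomial_word u 1 n) $ 1 $ 1 \<notin> {1, - 1}"
      "n = 3 * j \<Longrightarrow> continuant_matrix (trinomial_word u 2 n) $ 1 $ 1 \<notin> {1, - 1}"
      "n = 3 * j + 1 \<Longrightarrow> continuant_matrix (trinomial_word u 2 n) $ 1 $ 1 \<notin> {1, - 1}"
      "n = 3 * j + 2 \<Longrightarrow> continuant_matrix (trinomial_word u 2 n) $ 1 $ 1 \<notin> {1, - 1}"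
      using n by (simp_all only: vals neg zero not_False_eq_True)
        (rule min'; linarith)+
    have "(m + length r) mod 3 = 0 \<or> (m + length r) mod 3 = 1 \<or> (m + length r) mod 3 = 2" by linarith
    then consider "w = trinomial_word u 0 n" | "w = trinomial_word u 1 n" | "w = trinomial_word u 2 n"
      using w' by auto
    then have "w = trinomial_word u 1 n \<and> n = 3 * j + 2"
      using corner not_corner by cases (cases rule: length_cases; blast)+
    with corner quad[of j] n show "\<exists>j. j + 2 \<le> k \<and>
        (\<exists>e\<in>{1, - 1}. ((- u) ^ j)\<^sup>2 + e * (- u) ^ j = ?v\<^sup>2)"
      by (intro exI[of _ j]) auto
  next
    assume "\<exists>j. j + 2 \<le> k \<and> (\<exists>e\<in>{1, - 1}. ((- u) ^ j)\<^sup>2 + e * (- u) ^ j = ?v\<^sup>2)"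
    then obtain j where j: "j + 2 \<le> k"
      and corner: "continuant_matrix (trinomial_word u 1 (3 * j + 2)) $ 1 $ 1 \<in> {1, - 1}"
      using quad by blast
    define l where "l = 3 * k - (3 * j + 2)"
    have l: "l \<ge> 3" "l + (3 * j + 2) = 3 * k" using j by (auto simp: l_def)
    \<comment> \<open>The block following the first \<open>l\<close> letters then starts at
      \<open>3 * l + 1\<close>, which is 1 modulo 3.\<close>
    define m where "m = 2 * l + 1"
    have "trinomial_word u m (3 * k) = trinomial_word u m l @ trinomial_word u (m + l) (3 * j + 2)"
      using trinomial_word_add[of u m l "3 * j + 2"] l by simp
    also have "trinomial_word u (m + l) (3 * j + 2) = trinomial_word u 1 (3 * j + 2)"
      by (rule trinomial_word_cong_mod) (simp add: m_def mod_Suc)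
    finally have "tuple_equiv (trinomial_tuple u k) (trinomial_word u m l @ trinomial_word u 1 (3 * j + 2))"
      unfolding tuple_equiv_trinomial_tuple_iff by metis
    moreover have "trinomial_word u 1 (3 * j + 2) \<noteq> []"
      by (metis length_trinomial_word list.size(3) add_is_0 zero_neq_numeral)
    moreover have "is_solution (trinomial_tuple u k)"
      using sol is_solution_trinomial_tuple_iff[OF assms(1)] by simp
    ultimately show "reducible_solution (trinomial_tuple u k)"
      unfolding reducible_solution_iff using corner l(1) length_trinomial_word by metis
  qed
qed

section \<open>Generators of the unit group and roots of the quadratic\<close>

lemma generates_units_reduce:
  fixes g x :: "'a::field"
  assumes "generates_units g" and "g ^ k \<in> {1, - 1}" and "k \<ge> 1" and "x \<noteq> 0"
  shows "\<exists>j<k. x = g ^ j \<or> x = - (g ^ j)"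
proof -
  obtain n :: int where n: "x = g powi n" and g: "g \<noteq> 0"
    using assms unfolding generates_units_def by blast
  \<comment> \<open>Divide the exponent by \<open>k\<close>: as \<open>g ^ k\<close> is a sign, the
    quotient contributes only a sign. The integer remainder is nonnegative even for negative
    \<open>n\<close>.\<close>
  define j where "j = nat (n mod int k)"
  have j: "n mod int k = int j" "j < k"
    using assms(3) by (simp_all add: j_def nat_less_iff)
  have "g powi n = g powi (int k * (n div int k) + int j)"
    unfolding j(1)[symmetric] by simp
  also have "\<dots> = (g ^ k) powi (n div int k) * g ^ j"
    using g by (simp add: power_int_add power_int_mult)
  finally have "x = (g ^ k) powi (n div int k) * g ^ j" using n by simp
  moreover have "(g ^ k) powi (n div int k) \<in> {1, - 1}"
    using assms(2) by (auto simp: power_int_minus_left)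
  ultimately show ?thesis using j(2) by auto
qed

text \<open>Complete the square: \<open>(2 * p + e)\<^sup>2\<close> is the discriminant
  \<open>1 + 4 * (inverse u)\<^sup>2\<close>, and multiplying by \<open>u\<^sup>2\<close> clears the
  denominator.\<close>

lemma square_if_quadratic_root:
  fixes u p e :: "'a::field"
  assumes "u \<noteq> 0" and "e \<in> {1, - 1}" and "p\<^sup>2 + e * p = (inverse u)\<^sup>2"
  shows "is_square (u\<^sup>2 + 4)"
proof -
  have "(u * (2 * p + e))\<^sup>2 = u\<^sup>2 * (4 * (p\<^sup>2 + e * p) + e * e)"
    by (simp add: power2_eq_square algebra_simps)
  also have "\<dots> = u\<^sup>2 + 4"
    unfolding assms(3) using assms(1,2) by (auto simp: field_simps power2_eq_square)
  finally show ?thesis by (metis is_nth_power_nth_power)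
qed

lemma two_neq_0_if_CHAR:
  assumes "CHAR('a::field) \<noteq> 2"
  shows "(2 :: 'a) \<noteq> 0"
proof
  assume "(2 :: 'a) = 0"
  then have "of_nat 2 = (0 :: 'a)" by simp
  then have "CHAR('a) dvd 2" by (simp only: of_nat_eq_0_iff_char_dvd)
  then show False
    using assms CHAR_not_1[where 'a='a] two_is_prime_nat unfolding prime_nat_iff One_nat_def by blast
qed

text \<open>The quadratic formula, with \<open>t\<close> a square root of the discriminant. The
  equation with the opposite sign has the root \<open>- x\<close>, so one sign suffices.\<close>

lemma quadratic_root_if_square:
  fixes u :: "'a::field"
  assumes "(2 :: 'a) \<noteq> 0" and "u \<noteq> 0" and "is_square (u\<^sup>2 + 4)"
  obtains x where "x\<^sup>2 - x = (inverse u)\<^sup>2"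
proof -
  obtain s where s: "u\<^sup>2 + 4 = s\<^sup>2" using assms(3) by (auto elim: is_nth_powerE)
  define t where "t = s * inverse u"
  have t: "t\<^sup>2 = 1 + 4 * (inverse u)\<^sup>2"
    using assms(2) by (simp add: t_def power_mult_distrib s[symmetric] field_simps)
  have "(4 :: 'a) = 2 * 2" by simp
  then have "(4 :: 'a) \<noteq> 0" using assms(1) by (metis mult_eq_0_iff)
  define x where "x = (1 + t) / 2"
  have "2 * x = 1 + t" using assms(1) by (simp add: x_def)
  then have "t = 2 * x - 1" by (simp add: eq_diff_eq add.commute)
  then have "4 * (x\<^sup>2 - x) = t\<^sup>2 - 1"
    by (simp only:) (simp add: power2_eq_square algebra_simps)
  then have "4 * (x\<^sup>2 - x) = 4 * (inverse u)\<^sup>2"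
    by (simp add: t)
  then show thesis
    using \<open>4 \<noteq> 0\<close> by (metis mult_left_cancel that)
qed

section \<open>Both statements, from the criterion for the minimal \<open>k\<close>\<close>

theorem theorem6p4:
  fixes u :: "'k::{field, finite}"
  assumes "CHAR('k) \<noteq> 2"
    and "u \<noteq> 0" and "u \<noteq> 1" and "u \<noteq> - 1"
  shows "(\<not> is_square (u\<^sup>2 + 4) \<longrightarrow>
            irreducible_solution (trinomial_minimal_solution u)) \<and>
         (generates_units u \<or> generates_units (- u) \<longrightarrow>
            (irreducible_solution (trinomial_minimal_solution u) \<longleftrightarrow> \<not> is_square (u\<^sup>2 + 4)))"
proof -
  define k where "k = (LEAST k. k \<ge> 1 \<and> is_solution (trinomial_tuple u k))"
  have k: "k \<ge> 1" "is_solution (trinomial_tuple u k)"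
    using LeastI_ex[OF trinomial_solution_exists[of u]] by (simp_all add: k_def)
  have sol: "u ^ k \<in> {1, - 1}"
    using k(2) is_solution_trinomial_tuple_iff[OF assms(2)] by simp
  have min: "u ^ j \<notin> {1, - 1}" if "1 \<le> j" "j < k" for j
    using not_less_Least[of j "\<lambda>k. k \<ge> 1 \<and> is_solution (trinomial_tuple u k)"] that
      is_solution_trinomial_tuple_iff[OF assms(2)] by (simp add: k_def)
  have "length (trinomial_tuple u k) \<ge> 3"
    using k(1) by (simp add: trinomial_tuple_eq_word)
  then have irred: "irreducible_solution (trinomial_minimal_solution u) \<longleftrightarrow>
      \<not> reducible_solution (trinomial_tuple u k)"
    using k(2) by (simp add: irreducible_solution_def trinomial_minimal_solution_def k_def)
  have red: "reducible_solution (trinomial_tuple u k) \<longleftrightarrow>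
      (\<exists>j. j + 2 \<le> k \<and> (\<exists>e\<in>{1, - 1}. ((- u) ^ j)\<^sup>2 + e * (- u) ^ j = (inverse u)\<^sup>2))"
    using assms(2) sol min by (rule reducible_trinomial_iff)
  have square: "is_square (u\<^sup>2 + 4)" if "reducible_solution (trinomial_tuple u k)"
    using that square_if_quadratic_root[OF assms(2)] unfolding red by blast
  have "reducible_solution (trinomial_tuple u k)"
    if gen: "generates_units u \<or> generates_units (- u)" and sq: "is_square (u\<^sup>2 + 4)"
  proof -
    obtain x where x: "x\<^sup>2 - x = (inverse u)\<^sup>2"
      using quadratic_root_if_square[OF two_neq_0_if_CHAR[OF assms(1)] assms(2) sq] .
    have "x \<noteq> 0" using x assms(2) by auto
    obtain g where g: "generates_units g" "g = u \<or> g = - u" using gen by blast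
    have "g ^ k \<in> {1, - 1}" using g(2) sol power_uminus_in_signs_iff[of u k] by auto
    then obtain i where i: "i < k" "x = g ^ i \<or> x = - (g ^ i)"
      using generates_units_reduce[OF g(1) _ k(1) \<open>x \<noteq> 0\<close>] by blast
    \<comment> \<open>Whichever of \<open>u\<close> and \<open>- u\<close> generates,
      \<open>x\<close> is \<open>p\<close> or \<open>- p\<close>. This sign is absorbed by
      \<open>e\<close>: take \<open>- 1\<close> if \<open>x = p\<close> and 1 if
      \<open>x = - p\<close>.\<close>
    define p where "p = (- u) ^ i"
    have xp: "x = p \<or> x = - p"
      using i(2) g(2) by (cases "even i") (auto simp: p_def)
    then have "\<exists>e\<in>{1, - 1}. p\<^sup>2 + e * p = (inverse u)\<^sup>2"
      using x by auto
    \<comment> \<open>The criterion needs \<open>i + 2 \<le> k\<close>, while reduction of the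
      exponent gives only \<open>i < k\<close>. If \<open>i\<close> were \<open>k - 1\<close>, then
      \<open>(- u) * p\<close> would be a sign, so \<open>x\<^sup>2 = (inverse u)\<^sup>2\<close>,
      and the equation for \<open>x\<close> would give \<open>x = 0\<close>.\<close>
    moreover have "Suc i \<noteq> k"
    proof
      assume "Suc i = k"
      then have "(- u) * p \<in> {1, - 1}"
        using sol power_uminus_in_signs_iff[of u k] by (metis p_def power_Suc)
      then have "p = - inverse u \<or> p = inverse u"
        using assms(2) by (auto simp: field_simps minus_equation_iff)
      then have "x\<^sup>2 = (inverse u)\<^sup>2" using xp by auto
      with x \<open>x \<noteq> 0\<close> show False by simp
    qed
    ultimately show ?thesis
      unfolding red using i(1) by (auto simp: p_def intro!: exI[of _ i])
  qed
  with square irred show ?thesis by blast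
qed

end
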